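(* Let $q$ be a prime power, let $n>k\ge 2$ be integers, let $G\in\mathbb{F}_q^{k\times n}$ be a matrix of rank $k$ with no zero column, and let $\mathcal{R}=(\mathcal{R}_1,\ldots,\mathcal{R}_k)$ be a $G$-system. Then $$\lambda^2(\mathcal{R})\le\frac{k-1}{k}\,\lambda^*(\mathcal{R})\,\lambda(\mathcal{R})+\frac{(\lambda(\mathcal{R}))^2}{k}.$$
   Context: Let $G^\nu$ denote the $\nu$-th column of $G$ and $e_i$ the $i$-th standard basis vector (of $\mathbb{F}_q^k$ or of $\mathbb{R}^k$, according to context). For $i\in\{1,\ldots,k\}$ let $\mathcal{R}_i^{\mathrm{all}}(G)=\{R\subseteq\{1,\ldots,n\}\mid e_i\in\langle G^\nu\mid\nu\in R\rangle\}$, where $\langle\cdot\rangle$ is the $\mathbb{F}_q$-span. A $G$-system is a $k$-tuple $\mathcal{R}=(\mathcal{R}_1,\ldots,\mathcal{R}_k)$ with $\emptyset\ne\mathcal{R}_i\subseteq\mathcal{R}_i^{\mathrm{all}}(G)$ for all $i$. The service rate region $\Lambda(\mathcal{R})\subseteq\mathbb{R}^k$ (with server capacity $1$) is the set of all $(\lambda_1,\ldots,\lambda_k)\in\mathbb{R}^k$ for which there exist real numbers $\lambda_{i,R}\ge 0$ ($i\in\{1,\ldots,k\}$, $R\in\mathcal{R}_i$) with $\sum_{R\in\mathcal{R}_i}\lambda_{i,R}=\lambda_i$ for all $i$, and $\sum_{i=1}^k\sum_{R\in\mathcal{R}_i,\,\nu\in R}\lambda_{i,R}\le 1$ for all $\nu\in\{1,\ldots,n\}$.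 Define $\lambda^2(\mathcal{R})=\max\{\sum_{i=1}^k\lambda_i^2\mid\lambda\in\Lambda(\mathcal{R})\}$ (here the superscript $2$ in $\lambda^2(\mathcal{R})$ is an index, not a square), $\lambda(\mathcal{R})=\max\{\sum_{i=1}^k\lambda_i\mid\lambda\in\Lambda(\mathcal{R})\}$, $\lambda_i^*(\mathcal{R})=\max\{x\in\mathbb{R}\mid xe_i\in\Lambda(\mathcal{R})\}$ for $1\le i\le k$, and $\lambda^*(\mathcal{R})=\max\{\lambda_i^*(\mathcal{R})\mid 1\le i\le k\}$. *)

theory Defs
  imports "HOL-Analysis.Analysis"
begin

text \<open>
  The field \<open>\<bbbF>\<^sub>q\<close> is a type of class \<open>field\<close> and \<open>finite\<close>, the row indices \<open>{1,\<dots>,k}\<close> and the column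
  indices \<open>{1,\<dots>,n}\<close> are finite types. A tuple \<open>(\<R>\<^sub>1,\<dots>,\<R>\<^sub>k)\<close> is a function on the row index type.
\<close>

definition recovery_all :: "'a::field^'n^'k \<Rightarrow> 'k \<Rightarrow> 'n set set" where
  "recovery_all G i = {R. axis i 1 \<in> vec.span ((\<lambda>\<nu>. column \<nu> G) ` R)}"

definition G_system :: "'a::field^'n^'k \<Rightarrow> ('k \<Rightarrow> 'n set set) \<Rightarrow> bool" where
  "G_system G \<R> \<longleftrightarrow> (\<forall>i. \<R> i \<noteq> {} \<and> \<R> i \<subseteq> recovery_all G i)"

definition service_rate_region :: "('k::finite \<Rightarrow> 'n::finite set set) \<Rightarrow> (real^'k) set" where
  "service_rate_region \<R> =
    {x. \<exists>l :: 'k \<Rightarrow> 'n set \<Rightarrow> real.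
          (\<forall>i. \<forall>R\<in>\<R> i. 0 \<le> l i R) \<and>
          (\<forall>i. (\<Sum>R\<in>\<R> i. l i R) = x $ i) \<and>
          (\<forall>\<nu>. (\<Sum>i\<in>UNIV. \<Sum>R\<in>{R \<in> \<R> i. \<nu> \<in> R}. l i R) \<le> 1)}"

text \<open>
  Maxima over infinite sets of reals are expressed by \<open>GREATEST\<close>, which is the actual maximum
  if there is one and unspecified otherwise; \<open>Max\<close> is meaningful for finite sets only.
\<close>

text \<open>\<open>\<lambda>\<^sup>2(\<R>)\<close>; the superscript is an index, not a square.\<close>

definition max_sum_squares :: "('k::finite \<Rightarrow> 'n::finite set set) \<Rightarrow> real" where
  "max_sum_squares \<R> =
    (GREATEST s. s \<in> {(\<Sum>i\<in>UNIV. (x $ i)\<^sup>2) | x. x \<in> service_rate_region \<R>})"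

text \<open>\<open>\<lambda>(\<R>)\<close>\<close>

definition max_sum :: "('k::finite \<Rightarrow> 'n::finite set set) \<Rightarrow> real" where
  "max_sum \<R> =
    (GREATEST s. s \<in> {(\<Sum>i\<in>UNIV. x $ i) | x. x \<in> service_rate_region \<R>})"

text \<open>\<open>\<lambda>\<^sub>i\<^sup>*(\<R>)\<close> and \<open>\<lambda>\<^sup>*(\<R>)\<close>\<close>

definition max_axis :: "('k::finite \<Rightarrow> 'n::finite set set) \<Rightarrow> 'k \<Rightarrow> real" where
  "max_axis \<R> i = (GREATEST x. x *\<^sub>R axis i 1 \<in> service_rate_region \<R>)"

definition max_axes :: "('k::finite \<Rightarrow> 'n::finite set set) \<Rightarrow> real" where
  "max_axes \<R> = Max (range (max_axis \<R>))"

end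

theory Submission
  imports Defs
begin

text \<open>
  Write \<open>M\<close> for the largest axis value \<open>max_axes \<R>\<close> and \<open>S\<close> for \<open>max_sum \<R>\<close>. Dropping all requests
  but those for object \<open>i\<close> turns an achievable \<open>x\<close> into the achievable \<open>x\<^sub>i e\<^sub>i\<close>, so every achievable
  \<open>x\<close> has \<open>0 \<le> x\<^sub>i \<le> M\<close>. Therefore \<open>\<Sum> x\<^sub>i\<^sup>2 \<le> M \<Sum> x\<^sub>i \<le> M S\<close>. The point \<open>M e\<^sub>j\<close>, for an index \<open>j\<close>
  that attains \<open>M\<close>, is itself achievable and has coordinate sum \<open>M\<close>, so \<open>M \<le> S\<close>. Splitting
  \<open>M S = (k - 1)/k \<cdot> M S + M S/k\<close> and bounding the last term by \<open>S\<^sup>2/k\<close> gives the claim.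

  All of this presupposes that the maxima exist. The service rate region is the continuous image of
  a polytope of allocations, and that polytope is bounded because a recovery set is never empty
  (\<open>e\<^sub>i \<noteq> 0\<close> is not in the span of no columns): each allocated amount is counted at some server of
  capacity \<open>1\<close>. Hence the region is compact (\<open>compact_service_rate_region\<close>), and every continuous
  function attains its maximum on it.
\<close>

lemma Greatest_of_compact:
  fixes A :: "real set"
  assumes "compact A" and "A \<noteq> {}"
  shows "(GREATEST s. s \<in> A) \<in> A" and "\<And>s. s \<in> A \<Longrightarrow> s \<le> (GREATEST s. s \<in> A)"
proof -
  obtain m where m: "m \<in> A" "\<forall>s\<in>A. s \<le> m"
    using compact_attains_sup[OF assms] by blast
  then have "(GREATEST s. s \<in> A) = m"
    by (intro Greatest_equality) auto
  with m show "(GREATEST s. s \<in> A) \<in> A" and "\<And>s. s \<in> A \<Longrightarrow> s \<le> (GREATEST s. s \<in> A)"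
    by auto
qed

lemma empty_notin_recovery_all: "{} \<notin> recovery_all G i"
  by (simp add: recovery_all_def axis_eq_0_iff)

lemma zero_in_service_rate_region: "0 \<in> service_rate_region \<R>"
  by (auto simp: service_rate_region_def intro!: exI[of _ "\<lambda>_ _. 0"])

lemma service_rate_region_nonneg: "x \<in> service_rate_region \<R> \<Longrightarrow> 0 \<le> x $ i"
  by (auto simp: service_rate_region_def) (metis sum_nonneg)

text \<open>
  Allocations are functions of two arguments; encoding them as vectors indexed by pairs makes a
  Euclidean space of them. Fixing the coordinates outside the system \<open>\<R>\<close> to \<open>0\<close> keeps the
  polytope bounded, since no capacity constraint reaches them.
\<close>

definition allocation_polytope :: "('k::finite \<Rightarrow> 'n::finite set set) \<Rightarrow> (real^('k \<times> 'n set)) set" where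
  "allocation_polytope \<R> =
    {l. (\<forall>i R. 0 \<le> l $ (i, R)) \<and> (\<forall>i R. R \<notin> \<R> i \<longrightarrow> l $ (i, R) = 0) \<and>
        (\<forall>\<nu>. (\<Sum>i\<in>UNIV. \<Sum>R\<in>{R \<in> \<R> i. \<nu> \<in> R}. l $ (i, R)) \<le> 1)}"

lemma service_rate_region_eq_image:
  "service_rate_region \<R> = (\<lambda>l. \<chi> i. \<Sum>R\<in>\<R> i. l $ (i, R)) ` allocation_polytope \<R>"
proof (intro equalityI subsetI)
  fix x assume "x \<in> service_rate_region \<R>"
  then obtain l where l: "\<forall>i. \<forall>R\<in>\<R> i. 0 \<le> l i R" "\<forall>i. (\<Sum>R\<in>\<R> i. l i R) = x $ i"
    "\<forall>\<nu>. (\<Sum>i\<in>UNIV. \<Sum>R\<in>{R \<in> \<R> i. \<nu> \<in> R}. l i R) \<le> 1"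
    by (auto simp: service_rate_region_def)
  define v where "v = (\<chi> p. if snd p \<in> \<R> (fst p) then l (fst p) (snd p) else 0)"
  have "v \<in> allocation_polytope \<R>"
    using l by (auto simp: v_def allocation_polytope_def)
  moreover have "x = (\<chi> i. \<Sum>R\<in>\<R> i. v $ (i, R))"
    using l by (simp add: v_def vec_eq_iff)
  ultimately show "x \<in> (\<lambda>l. \<chi> i. \<Sum>R\<in>\<R> i. l $ (i, R)) ` allocation_polytope \<R>"
    by blast
next
  fix x assume "x \<in> (\<lambda>l. \<chi> i. \<Sum>R\<in>\<R> i. l $ (i, R)) ` allocation_polytope \<R>"
  then obtain v where "v \<in> allocation_polytope \<R>" "x = (\<chi> i. \<Sum>R\<in>\<R> i. v $ (i, R))"
    by blast
  then show "x \<in> service_rate_region \<R>"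
    by (auto simp: service_rate_region_def allocation_polytope_def
        intro!: exI[of _ "\<lambda>i R. v $ (i, R)"])
qed

text \<open>
  A nonempty recovery set contains some server, and the capacity constraint of that server bounds
  the amount allocated to the set.
\<close>

lemma allocation_le_1:
  assumes "\<And>i. {} \<notin> \<R> i" and "l \<in> allocation_polytope \<R>"
  shows "l $ (i, R) \<le> 1"
proof (cases "R \<in> \<R> i")
  case True
  with assms(1) obtain \<nu> where "\<nu> \<in> R" by (metis ex_in_conv)
  have nonneg: "\<And>j Q. 0 \<le> l $ (j, Q)"
    using assms(2) by (simp add: allocation_polytope_def)
  have "l $ (i, R) \<le> (\<Sum>Q\<in>{Q \<in> \<R> i. \<nu> \<in> Q}. l $ (i, Q))"
    using True \<open>\<nu> \<in> R\<close> nonneg by (intro member_le_sum) auto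
  also have "\<dots> \<le> (\<Sum>j\<in>UNIV. \<Sum>Q\<in>{Q \<in> \<R> j. \<nu> \<in> Q}. l $ (j, Q))"
    using nonneg by (intro member_le_sum[where f = "\<lambda>j. \<Sum>Q\<in>{Q \<in> \<R> j. \<nu> \<in> Q}. l $ (j, Q)"])
      (auto intro: sum_nonneg)
  also have "\<dots> \<le> 1"
    using assms(2) by (simp add: allocation_polytope_def)
  finally show ?thesis .
next
  case False
  with assms(2) show ?thesis by (simp add: allocation_polytope_def)
qed

lemma compact_allocation_polytope:
  assumes "\<And>i. {} \<notin> \<R> i"
  shows "compact (allocation_polytope \<R>)"
proof -
  have "closed (allocation_polytope \<R>)"
    unfolding allocation_polytope_def
    by (intro closed_Collect_conj closed_Collect_all closed_Collect_imp closed_Collect_le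
        closed_Collect_eq open_Collect_const continuous_intros)
  moreover have "allocation_polytope \<R> \<subseteq> cbox 0 (\<chi> p. 1)"
    using allocation_le_1[of \<R>] assms by (auto simp: mem_box_cart allocation_polytope_def)
  then have "bounded (allocation_polytope \<R>)"
    using bounded_cbox bounded_subset by blast
  ultimately show ?thesis
    by (simp add: compact_eq_bounded_closed)
qed

lemma compact_service_rate_region:
  assumes "\<And>i. {} \<notin> \<R> i"
  shows "compact (service_rate_region \<R>)"
  unfolding service_rate_region_eq_image
  by (intro compact_continuous_image compact_allocation_polytope assms continuous_intros)

text \<open>Serving only the requests for object \<open>i\<close> relieves every server.\<close>

lemma axis_projection_in_service_rate_region:
  assumes "x \<in> service_rate_region \<R>"
  shows "x $ i *\<^sub>R axis i 1 \<in> service_rate_region \<R>"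
proof -
  obtain l where l: "\<forall>i. \<forall>R\<in>\<R> i. 0 \<le> l i R" "\<forall>i. (\<Sum>R\<in>\<R> i. l i R) = x $ i"
    "\<forall>\<nu>. (\<Sum>i\<in>UNIV. \<Sum>R\<in>{R \<in> \<R> i. \<nu> \<in> R}. l i R) \<le> 1"
    using assms by (auto simp: service_rate_region_def)
  define m where "m = (\<lambda>j R. if j = i then l j R else 0)"
  have "\<forall>j. \<forall>R\<in>\<R> j. 0 \<le> m j R"
    using l by (simp add: m_def)
  moreover have "\<forall>j. (\<Sum>R\<in>\<R> j. m j R) = (x $ i *\<^sub>R axis i 1) $ j"
    using l by (auto simp: m_def axis_def)
  moreover have "(\<Sum>j\<in>UNIV. \<Sum>R\<in>{R \<in> \<R> j. \<nu> \<in> R}. m j R) \<le> 1" for \<nu>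
  proof -
    have "(\<Sum>j\<in>UNIV. \<Sum>R\<in>{R \<in> \<R> j. \<nu> \<in> R}. m j R) \<le> (\<Sum>j\<in>UNIV. \<Sum>R\<in>{R \<in> \<R> j. \<nu> \<in> R}. l j R)"
      using l by (intro sum_mono) (auto simp: m_def)
    with l show ?thesis by (meson order_trans)
  qed
  ultimately show ?thesis
    unfolding service_rate_region_def by blast
qed

text \<open>
  By the projection property, the axis values are exactly the coordinates of achievable points;
  compactness of this set is then inherited from the region.
\<close>

lemma axis_values_eq_image:
  "{t. t *\<^sub>R axis i 1 \<in> service_rate_region \<R>} = (\<lambda>x. x $ i) ` service_rate_region \<R>"
proof (intro equalityI subsetI)
  fix t assume "t \<in> {t. t *\<^sub>R axis i 1 \<in> service_rate_region \<R>}"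
  then show "t \<in> (\<lambda>x. x $ i) ` service_rate_region \<R>"
    by (intro image_eqI[of _ _ "t *\<^sub>R axis i 1"]) (auto simp: axis_def)
qed (auto intro: axis_projection_in_service_rate_region)

lemma max_axis_properties:
  assumes "\<And>i. {} \<notin> \<R> i"
  shows "max_axis \<R> i *\<^sub>R axis i 1 \<in> service_rate_region \<R>"
    and "x \<in> service_rate_region \<R> \<Longrightarrow> x $ i \<le> max_axis \<R> i"
proof -
  let ?A = "{t. t *\<^sub>R axis i 1 \<in> service_rate_region \<R>}"
  have "compact ?A" unfolding axis_values_eq_image
    by (intro compact_continuous_image compact_service_rate_region assms continuous_intros)
  moreover have "?A \<noteq> {}"
    using zero_in_service_rate_region by (auto simp: axis_values_eq_image)
  ultimately have G: "(GREATEST t. t \<in> ?A) \<in> ?A" "\<And>t. t \<in> ?A \<Longrightarrow> t \<le> (GREATEST t. t \<in> ?A)"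
    using Greatest_of_compact[of ?A] by blast+
  have eq: "max_axis \<R> i = (GREATEST t. t \<in> ?A)"
    by (simp add: max_axis_def)
  show "max_axis \<R> i *\<^sub>R axis i 1 \<in> service_rate_region \<R>"
    using G(1) unfolding eq by blast
  show "x $ i \<le> max_axis \<R> i" if "x \<in> service_rate_region \<R>"
    unfolding eq using that by (intro G(2)) (simp add: axis_projection_in_service_rate_region)
qed

lemma coordinate_le_max_axes:
  assumes "\<And>i. {} \<notin> \<R> i" and "x \<in> service_rate_region \<R>"
  shows "x $ i \<le> max_axes \<R>"
proof -
  have "x $ i \<le> max_axis \<R> i"
    using max_axis_properties(2) assms by blast
  also have "\<dots> \<le> max_axes \<R>"
    by (simp add: max_axes_def)
  finally show ?thesis .
qed

lemma sum_le_max_sum: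
  assumes "\<And>i. {} \<notin> \<R> i" and "x \<in> service_rate_region \<R>"
  shows "(\<Sum>i\<in>UNIV. x $ i) \<le> max_sum \<R>"
proof -
  let ?A = "{(\<Sum>i\<in>UNIV. x $ i) | x. x \<in> service_rate_region \<R>}"
  have "compact ?A" unfolding Setcompr_eq_image
    by (intro compact_continuous_image compact_service_rate_region assms continuous_intros)
  then show ?thesis unfolding max_sum_def
    using assms(2) by (intro Greatest_of_compact(2)) auto
qed

lemma max_sum_squares_attained:
  assumes "\<And>i. {} \<notin> \<R> i"
  obtains x where "x \<in> service_rate_region \<R>" and "max_sum_squares \<R> = (\<Sum>i\<in>UNIV. (x $ i)\<^sup>2)"
proof -
  let ?A = "{(\<Sum>i\<in>UNIV. (x $ i)\<^sup>2) | x. x \<in> service_rate_region \<R>}"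
  have "compact ?A" unfolding Setcompr_eq_image
    by (intro compact_continuous_image compact_service_rate_region assms continuous_intros)
  moreover have "?A \<noteq> {}"
    using zero_in_service_rate_region by blast
  ultimately have "max_sum_squares \<R> \<in> ?A"
    unfolding max_sum_squares_def by (rule Greatest_of_compact(1))
  then show ?thesis using that by blast
qed

lemma max_axes_nonneg:
  assumes "\<And>i. {} \<notin> \<R> i"
  shows "0 \<le> max_axes \<R>"
  using coordinate_le_max_axes[OF assms zero_in_service_rate_region] by simp

lemma max_axes_le_max_sum:
  assumes "\<And>i. {} \<notin> \<R> i"
  shows "max_axes \<R> \<le> max_sum \<R>"
proof -
  have "max_axes \<R> \<in> range (max_axis \<R>)"
    unfolding max_axes_def by (intro Max_in) auto
  then obtain j where j: "max_axes \<R> = max_axis \<R> j" by blast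
  have "(\<Sum>i\<in>UNIV. (max_axis \<R> j *\<^sub>R axis j 1) $ i) \<le> max_sum \<R>"
    using assms by (intro sum_le_max_sum max_axis_properties(1))
  then show ?thesis by (simp add: j axis_def if_distrib cong: if_cong)
qed

text \<open>
  This bound is at least as strong as the one in the theorem, which replaces a share \<open>1/k\<close> of it
  by a multiple of \<open>(max_sum \<R>)\<^sup>2\<close>.
\<close>

lemma max_sum_squares_le:
  assumes "\<And>i. {} \<notin> \<R> i"
  shows "max_sum_squares \<R> \<le> max_axes \<R> * max_sum \<R>"
proof -
  obtain x where x: "x \<in> service_rate_region \<R>" "max_sum_squares \<R> = (\<Sum>i\<in>UNIV. (x $ i)\<^sup>2)"
    using max_sum_squares_attained[of \<R>] assms by blast
  have "(\<Sum>i\<in>UNIV. (x $ i)\<^sup>2) \<le> (\<Sum>i\<in>UNIV. max_axes \<R> * x $ i)"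
    unfolding power2_eq_square
    using coordinate_le_max_axes[OF assms x(1)] service_rate_region_nonneg[OF x(1)]
    by (intro sum_mono mult_right_mono)
  also have "\<dots> = max_axes \<R> * (\<Sum>i\<in>UNIV. x $ i)"
    by (simp add: sum_distrib_left)
  also have "\<dots> \<le> max_axes \<R> * max_sum \<R>"
    using assms x(1) by (intro mult_left_mono sum_le_max_sum max_axes_nonneg)
  finally show ?thesis using x(2) by simp
qed

theorem theorem4p7:
  fixes G :: "'a::{field,finite}^'n^'k"
    and \<R> :: "'k \<Rightarrow> 'n set set"
  assumes "CARD('k) \<ge> 2"
    and "CARD('n) > CARD('k)"
    and "rank G = CARD('k)"
    and "\<forall>\<nu>. column \<nu> G \<noteq> 0"
    and "G_system G \<R>"
  shows "max_sum_squares \<R>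
    \<le> (real CARD('k) - 1) / real CARD('k) * max_axes \<R> * max_sum \<R>
      + (max_sum \<R>)\<^sup>2 / real CARD('k)"
proof -
  let ?k = "real CARD('k)" and ?M = "max_axes \<R>" and ?S = "max_sum \<R>"
  have ne: "{} \<notin> \<R> i" for i
    using assms(5) empty_notin_recovery_all[of G i] by (auto simp: G_system_def)
  have "max_sum_squares \<R> \<le> ?M * ?S"
    using ne by (rule max_sum_squares_le)
  also have "\<dots> = (?k - 1) / ?k * ?M * ?S + ?M * ?S / ?k"
    by (simp add: field_simps)
  also have "?M * ?S / ?k \<le> ?S\<^sup>2 / ?k"
    unfolding power2_eq_square
    using max_axes_le_max_sum[of \<R>] max_axes_nonneg[of \<R>] ne
    by (intro divide_right_mono mult_right_mono) (auto intro: order_trans)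
  finally show ?thesis by simp
qed

end
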